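(* Let $n\ge 2$ be an integer and let $K\ge 1$, $K'\ge 0$ be constants. Let $f$ be a Bochner $(K,K')$-mapping from $\overline{B}^n$ to $\mathbb{C}^n$ with $|\det f'(0)|=1$. Then $f$ maps some subdomain of the unit ball $B^n$ univalently onto a ball of positive radius $$R(n,K,K')=\frac{1}{4(K^2+K')^{n-1}}\left(\sqrt{4K^2+K'}+\sqrt{K^2+K'}\right)^{-1}.$$
   Context: $B^n=\{z\in\mathbb{C}^n:|z|<1\}$ is the open unit ball for the Euclidean norm $|z|=(\sum_j|z_j|^2)^{1/2}$, and $\overline{B}^n$ is its closure. For a holomorphic mapping $f=(f_1,\dots,f_n)$ into $\mathbb{C}^n$, $f'(z)=(\partial f_i/\partial z_k)_{i,k}$ is the $n\times n$ complex Jacobian matrix. For an $n\times n$ matrix $A=(a_{ij})$, $\|A\|=(\sum_{i,j}|a_{ij}|^2)^{1/2}$. For constants $K\ge1$, $K'\ge0$, a holomorphic mapping $f$ into $\mathbb{C}^n$ is a Bochner $(K,K')$-mapping if $\|f'(z)\|^2\le K^2|\det f'(z)|^{2/n}+K'$ at every point $z$ of its domain. A mapping on $\overline{B}^n$ is called holomorphic if it is holomorphic in an open neighborhood of $\overline{B}^n$; a Bochner $(K,K')$-mapping from $\overline{B}^n$ satisfies the inequality at each point of $\overline{B}^n$. A subdomain is a nonempty connected open subset; univalent means injective. *)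

theory Defs
  imports "HOL-Analysis.Analysis"
begin

text \<open>
  Holomorphy in several variables as complex Frechet differentiability: the real derivative
  at each point is given by a complex matrix. Intended for open \<open>U\<close>.
\<close>
definition holomorphic_map_on :: "(complex ^ 'n \<Rightarrow> complex ^ 'm) \<Rightarrow> (complex ^ 'n) set \<Rightarrow> bool"
    (infixl "holomorphic'_map'_on" 50) where
  "f holomorphic_map_on U \<longleftrightarrow>
     (\<forall>z\<in>U. \<exists>A :: complex ^ 'n ^ 'm. (f has_derivative (\<lambda>h. A *v h)) (at z))"

definition cjacobian :: "(complex ^ 'n \<Rightarrow> complex ^ 'm) \<Rightarrow> complex ^ 'n \<Rightarrow> complex ^ 'n ^ 'm" where
  "cjacobian f z = (\<chi> i k. deriv (\<lambda>w. f (\<chi> j. if j = k then w else z $ j) $ i) (z $ k))"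

definition frobenius_norm :: "complex ^ 'n ^ 'm \<Rightarrow> real" where
  "frobenius_norm A = sqrt (\<Sum>i\<in>UNIV. \<Sum>j\<in>UNIV. (cmod (A $ i $ j))\<^sup>2)"

text \<open>
  On a set \<open>S\<close> that need not be open, holomorphic means holomorphic in an open
  neighbourhood of \<open>S\<close>; the inequality is only required on \<open>S\<close> itself.
\<close>
definition bochner_map_on ::
    "real \<Rightarrow> real \<Rightarrow> (complex ^ 'n \<Rightarrow> complex ^ 'n) \<Rightarrow> (complex ^ 'n) set \<Rightarrow> bool" where
  "bochner_map_on K K' f S \<longleftrightarrow>
     (\<exists>U. open U \<and> S \<subseteq> U \<and> f holomorphic_map_on U) \<and>
     (\<forall>z\<in>S. (frobenius_norm (cjacobian f z))\<^sup>2
              \<le> K\<^sup>2 * cmod (det (cjacobian f z)) powr (2 / real CARD('n)) + K')"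

definition bloch_radius :: "nat \<Rightarrow> real \<Rightarrow> real \<Rightarrow> real" where
  "bloch_radius n K K' =
     1 / (4 * (K\<^sup>2 + K') ^ (n - 1)) * inverse (sqrt (4 * K\<^sup>2 + K') + sqrt (K\<^sup>2 + K'))"

lemma cjacobian_eq_derivative:
  fixes A :: "complex ^ 'n ^ 'm"
  assumes "(f has_derivative (\<lambda>h. A *v h)) (at z)"
  shows "cjacobian f z = A"
proof -
  have "deriv (\<lambda>w. f (\<chi> j. if j = k then w else z $ j) $ i) (z $ k) = A $ i $ k" for i k
  proof (rule DERIV_imp_deriv)
    define g where "g = (\<lambda>w. \<chi> j. if j = k then w else z $ j)"
    have g: "g (z $ k) = z"
      by (simp add: g_def vec_eq_iff)
    have "(g has_derivative (\<lambda>h. \<chi> j. if j = k then h else 0)) (at (z $ k))"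
    proof -
      let ?L = "\<lambda>h :: complex. \<chi> j. if j = k then h else 0"
      have "linear ?L"
        by (rule linearI) (auto simp: vec_eq_iff)
      then have L: "bounded_linear ?L"
        by (rule linear_conv_bounded_linear[THEN iffD1])
      have "((\<lambda>w. w - z $ k) has_derivative (\<lambda>h. h)) (at (z $ k))"
        by (rule has_derivative_eq_rhs, (rule derivative_intros)+) simp
      from has_derivative_add[OF has_derivative_const bounded_linear.has_derivative[OF L this]]
      have "((\<lambda>w. z + ?L (w - z $ k)) has_derivative ?L) (at (z $ k))"
        by simp
      moreover have "(\<lambda>w. z + ?L (w - z $ k)) = (\<lambda>w. \<chi> j. if j = k then w else z $ j)"
        by (auto simp: vec_eq_iff fun_eq_iff)
      ultimately show ?thesis by (simp add: g_def)
    qed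
    then have "(f \<circ> g has_derivative (\<lambda>h. A *v h) \<circ> (\<lambda>h. \<chi> j. if j = k then h else 0)) (at (z $ k))"
      by (rule diff_chain_at) (simp add: g assms)
    then have "((\<lambda>w. f (g w) $ i) has_derivative (\<lambda>h. (A *v (\<chi> j. if j = k then h else 0)) $ i)) (at (z $ k))"
      by (drule_tac bounded_linear.has_derivative[OF bounded_linear_vec_nth[of i]]) (simp add: o_def)
    moreover have "(\<lambda>h. (A *v (\<chi> j. if j = k then h else 0)) $ i) = (*) (A $ i $ k)"
      by (simp add: matrix_vector_mult_def fun_eq_iff if_distrib cong: if_cong)
    ultimately show "((\<lambda>w. f (\<chi> j. if j = k then w else z $ j) $ i) has_field_derivative A $ i $ k) (at (z $ k))"
      by (simp add: has_field_derivative_def g_def)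
  qed
  then show ?thesis
    by (simp add: cjacobian_def vec_eq_iff)
qed

end

theory Submission
  imports Defs "HOL-Complex_Analysis.Conformal_Mappings"
begin

text \<open>
  The idea is Landau's argument for Bloch's theorem. Let \<open>a\<close> maximize
  \<open>(1 - norm z) ^ n * cmod (det (f' z))\<close> on the closed unit ball, put \<open>t = 1 - norm a\<close> and let \<open>d\<close> be the
  \<open>n\<close>-th root of \<open>cmod (det (f' a))\<close>. Comparison with \<open>0\<close> shows \<open>t * d \<ge> 1\<close>, hence \<open>d \<ge> 1\<close>, and on
  \<open>ball a (t / 2)\<close> the determinant is at most \<open>(2 * d) ^ n\<close> (\<open>exists_dominating_point\<close>). The Bochner
  inequality turns this, for Frobenius norms, into \<open>norm (f' z) \<le> d * M\<close> on that ball
  and \<open>norm (f' a) \<le> d * m\<close>, where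
  \<open>M = sqrt (4 * K\<^sup>2 + K')\<close> and \<open>m = sqrt (K\<^sup>2 + K')\<close>.

  Two estimates feed the covering argument. Schwarz's lemma, applied to \<open>f' z - f' a\<close>, gives
  \<open>norm (f' z - f' a) \<le> L * norm (z - a)\<close> with \<open>L = 2 * d * (M + m) / t\<close> (\<open>norm_derivative_diff_le\<close>).
  Linear algebra bounds the least singular value of \<open>f' a\<close> from below by
  \<open>lam = d ^ n / (d * m) ^ (n - 1) = d / m ^ (n - 1)\<close> (\<open>det_mult_norm_le\<close>, by way of Cramer's rule and
  Hadamard's inequality). A map whose derivative satisfies both is injective on the ball of radius
  \<open>lam / L\<close> around \<open>a\<close> and covers the ball of radius \<open>lam\<^sup>2 / (2 * L)\<close> around \<open>f a\<close>
  (\<open>covers_ball_if_derivative_Lipschitz\<close>). That radius equals \<open>t * d\<close> times the asserted one, hence is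
  no smaller.

  The existence of the maximum point requires \<open>f'\<close> to be continuous. This, too, comes from the
  Schwarz estimate, now combined with Cauchy's inequality (\<open>continuous_on_jacobian_entry\<close>).
\<close>

section \<open>The least singular value and the determinant\<close>

text \<open>
  The inner product that \<^typ>\<open>complex ^ 'n\<close> carries as a Euclidean space is only the real part
  of this sesquilinear form. Complex orthogonality, and the complex linear functionals
  used below to reduce vector-valued maps to scalar ones, need the full form.
\<close>

definition hermitian_inner :: "complex ^ 'n \<Rightarrow> complex ^ 'n \<Rightarrow> complex" where
  "hermitian_inner x y = (\<Sum>i\<in>UNIV. x $ i * cnj (y $ i))"

lemma hermitian_inner_self: "hermitian_inner x x = complex_of_real ((norm x)\<^sup>2)"
  by (simp add: hermitian_inner_def norm_vec_def L2_set_def sum_nonneg complex_norm_square flip: of_real_power)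

lemma norm_power2_eq_sum: "(norm (x :: complex ^ 'n))\<^sup>2 = (\<Sum>i\<in>UNIV. (cmod (x $ i))\<^sup>2)"
  by (simp add: norm_vec_def L2_set_def sum_nonneg)

text \<open>
  The bilinear form of Cauchy--Schwarz serves the rows of a matrix, where no conjugate occurs;
  the sesquilinear one follows by conjugating \<open>y\<close>.
\<close>

lemma norm_sum_mult_le:
  fixes x y :: "complex ^ 'n"
  shows "cmod (\<Sum>i\<in>UNIV. x $ i * y $ i) \<le> norm x * norm y"
proof -
  have "cmod (\<Sum>i\<in>UNIV. x $ i * y $ i) \<le> (\<Sum>i\<in>UNIV. \<bar>cmod (x $ i)\<bar> * \<bar>cmod (y $ i)\<bar>)"
    by (rule order_trans[OF norm_sum]) (simp add: norm_mult)
  also have "\<dots> \<le> norm x * norm y"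
    unfolding norm_vec_def by (rule L2_set_mult_ineq)
  finally show ?thesis .
qed

lemma norm_hermitian_inner_le: "cmod (hermitian_inner x y) \<le> norm x * norm y"
proof -
  have "norm (\<chi> i. cnj (y $ i)) = norm y"
    by (simp add: norm_vec_def)
  then show ?thesis
    using norm_sum_mult_le[of x "\<chi> i. cnj (y $ i)"] by (simp add: hermitian_inner_def)
qed

lemma norm_vector_scalar_mult: "norm (c *s x) = cmod c * norm (x :: complex ^ 'n)"
  by (simp add: norm_vec_def L2_set_def norm_mult power_mult_distrib real_sqrt_mult
      flip: sum_distrib_left)

lemma norm_matrix_vector_mult_le:
  "norm (A *v h) \<le> frobenius_norm A * norm (h :: complex ^ 'n)"
proof (rule power2_le_imp_le)
  have "cmod ((A *v h) $ i) \<le> norm (A $ i) * norm h" for i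
    unfolding matrix_vector_mult_def vec_lambda_beta by (rule norm_sum_mult_le)
  then have "(\<Sum>i\<in>UNIV. (cmod ((A *v h) $ i))\<^sup>2) \<le> (\<Sum>i\<in>UNIV. (norm (A $ i) * norm h)\<^sup>2)"
    by (intro sum_mono power_mono) auto
  also have "\<dots> = (frobenius_norm A * norm h)\<^sup>2"
    by (simp add: power_mult_distrib norm_power2_eq_sum frobenius_norm_def sum_nonneg
        flip: sum_distrib_right)
  finally show "(norm (A *v h))\<^sup>2 \<le> (frobenius_norm A * norm h)\<^sup>2"
    by (simp only: norm_power2_eq_sum)
qed (simp add: frobenius_norm_def sum_nonneg)

text \<open>
  The real and imaginary parts of the Hermitian product are the real inner products of \<open>x\<close> with
  \<open>y\<close> and with \<open>\<i> *s y\<close>. Real orthogonal projection onto a complex subspace, which contains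
  \<open>\<i> *s y\<close> along with \<open>y\<close>, thus gives Hermitian orthogonality.
\<close>

lemma hermitian_inner_eq_0:
  assumes "orthogonal x y" "orthogonal x (\<i> *s y)"
  shows "hermitian_inner x y = 0"
proof (rule complex_eqI)
  show "Re (hermitian_inner x y) = Re 0" "Im (hermitian_inner x y) = Im 0"
    using assms by (simp_all add: hermitian_inner_def orthogonal_def inner_vec_def inner_complex_def
        algebra_simps sum_subtractf sum_negf sum.distrib)
qed

lemma hermitian_inner_commute: "hermitian_inner y x = cnj (hermitian_inner x y)"
  by (simp add: hermitian_inner_def mult.commute)

text \<open>
  Gram--Schmidt on rows: replacing a row by its component orthogonal to the complex span of the
  rows already treated subtracts a combination of other rows, which keeps the determinant, and
  is an orthogonal projection, which does not increase the norm.
\<close>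

lemma orthogonalize_rows:
  fixes A :: "complex ^ 'n ^ 'n"
  assumes "finite S"
  shows "\<exists>B. det B = det A \<and> (\<forall>i. norm (B $ i) \<le> norm (A $ i)) \<and>
             (\<forall>i\<in>S. \<forall>j\<in>S. i \<noteq> j \<longrightarrow> hermitian_inner (B $ i) (B $ j) = 0)"
  using assms
proof (induction S)
  case empty
  then show ?case by auto
next
  case (insert i S)
  then obtain B where B: "det B = det A" "\<And>i. norm (B $ i) \<le> norm (A $ i)"
    "\<And>i j. i \<in> S \<Longrightarrow> j \<in> S \<Longrightarrow> i \<noteq> j \<Longrightarrow> hermitian_inner (B $ i) (B $ j) = 0"
    by blast
  define W where "W = vec.span ((\<lambda>j. B $ j) ` S)"
  have cW: "c *s x \<in> W" if "x \<in> W" for c x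
    using that by (simp add: W_def vec.span_scale)
  have "c *\<^sub>R x \<in> W" if "x \<in> W" for c x
  proof -
    have "c *\<^sub>R x = complex_of_real c *s x"
      unfolding vec_eq_iff vector_scaleR_component vector_smult_component
      by (simp add: scaleR_conv_of_real)
    then show ?thesis using cW[OF that] by simp
  qed
  then have "subspace W"
    unfolding subspace_def by (auto simp: W_def vec.span_zero vec.span_add)
  then have spanW: "span W = W"
    by (simp add: span_eq_iff)
  obtain p z where p: "p \<in> W" and z: "\<And>w. w \<in> W \<Longrightarrow> orthogonal z w" and pz: "B $ i = p + z"
    using orthogonal_subspace_decomp_exists[of W "B $ i"] spanW by metis
  define B' where "B' = (\<chi> k. if k = i then z else B $ k)"
  have "W \<subseteq> vec.span {row j B |j. j \<noteq> i}"
    unfolding W_def by (rule vec.span_mono) (use insert.hyps in \<open>auto simp: row_def\<close>)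
  then have "- p \<in> vec.span {row j B |j. j \<noteq> i}"
    using p by (auto intro: vec.span_neg)
  from det_row_span[OF this]
  have "det (\<chi> k. if k = i then row i B + - p else row k B) = det B" .
  moreover have "(\<chi> k. if k = i then row i B + - p else row k B) = B'"
    by (simp add: B'_def vec_eq_iff row_def pz)
  ultimately have det: "det B' = det A"
    using B by simp
  have "(norm (B $ i))\<^sup>2 = (norm p)\<^sup>2 + (norm z)\<^sup>2"
    unfolding pz by (rule norm_add_Pythagorean) (use z[OF p] in \<open>simp add: orthogonal_commute\<close>)
  then have "(norm z)\<^sup>2 \<le> (norm (B $ i))\<^sup>2"
    by (metis le_add_same_cancel2 zero_le_power2)
  then have "norm z \<le> norm (B $ i)"
    by (rule power2_le_imp_le) simp
  then have nz: "norm (B' $ k) \<le> norm (A $ k)" for k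
    using B(2)[of i] B(2)[of k] by (auto simp: B'_def)
  have hz: "hermitian_inner z (B $ j) = 0" if "j \<in> S" for j
  proof -
    have "B $ j \<in> W"
      using that by (simp add: W_def vec.span_base)
    then show ?thesis
      by (intro hermitian_inner_eq_0 z cW)
  qed
  then have hz': "hermitian_inner (B $ j) z = 0" if "j \<in> S" for j
    using that by (simp add: hermitian_inner_commute[of _ z])
  have "hermitian_inner (B' $ k) (B' $ l) = 0" if "k \<in> insert i S" "l \<in> insert i S" "k \<noteq> l" for k l
    using that B(3) hz hz' insert.hyps by (auto simp: B'_def)
  then show ?case
    using det nz by blast
qed

text \<open>
  Hadamard's inequality. For pairwise orthogonal rows \<open>B B\<^sup>*\<close> is diagonal with the squared row norms
  as entries, so equality holds there; orthogonalization reduces the general case to this one.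
\<close>

lemma hadamard_rows:
  fixes A :: "complex ^ 'n ^ 'n"
  shows "cmod (det A) \<le> (\<Prod>i\<in>UNIV. norm (A $ i))"
proof -
  obtain B where B: "det B = det A" "\<And>i. norm (B $ i) \<le> norm (A $ i)"
    "\<And>i j. i \<noteq> j \<Longrightarrow> hermitian_inner (B $ i) (B $ j) = 0"
    using orthogonalize_rows[of UNIV A] by auto
  define C where "C = (\<chi> i j. cnj (B $ j $ i))"
  have "det C = det (transpose C)"
    by simp
  also have "\<dots> = cnj (det B)"
    by (simp add: det_def C_def transpose_def)
  finally have "det (B ** C) = det B * cnj (det B)"
    by (simp add: det_mul)
  moreover have BC: "(B ** C) $ i $ j = hermitian_inner (B $ i) (B $ j)" for i j
    by (simp add: matrix_matrix_mult_def C_def hermitian_inner_def)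
  have "det (B ** C) = (\<Prod>i\<in>UNIV. (B ** C) $ i $ i)"
    by (rule det_diagonal) (simp add: BC B)
  then have "det (B ** C) = complex_of_real ((\<Prod>i\<in>UNIV. norm (B $ i))\<^sup>2)"
    by (simp add: BC hermitian_inner_self prod_power_distrib)
  ultimately have "complex_of_real ((cmod (det B))\<^sup>2) = complex_of_real ((\<Prod>i\<in>UNIV. norm (B $ i))\<^sup>2)"
    by (metis complex_norm_square)
  then have "(cmod (det B))\<^sup>2 = (\<Prod>i\<in>UNIV. norm (B $ i))\<^sup>2"
    using of_real_eq_iff by blast
  then have "cmod (det B) = (\<Prod>i\<in>UNIV. norm (B $ i))"
    by (subst (asm) power2_eq_iff_nonneg) (auto intro: prod_nonneg)
  also have "\<dots> \<le> (\<Prod>i\<in>UNIV. norm (A $ i))"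
    by (intro prod_mono) (simp add: B)
  finally show ?thesis by (simp add: B)
qed

text \<open>
  The left-hand side is the elementary symmetric polynomial of degree \<open>card S - 1\<close>. Each of its
  monomials also occurs in the expansion of the power on the right, whose other terms are
  nonnegative. The induction splits off one variable.
\<close>

lemma sum_prod_remove_le_power:
  fixes x :: "'i \<Rightarrow> real"
  assumes "finite S" "S \<noteq> {}" "\<And>i. i \<in> S \<Longrightarrow> 0 \<le> x i"
  shows "(\<Sum>k\<in>S. \<Prod>j\<in>S - {k}. x j) \<le> (\<Sum>i\<in>S. x i) ^ (card S - 1)"
  using assms
proof (induction S rule: finite_ne_induct)
  case (singleton i)
  then show ?case by simp
next
  case (insert y S)
  let ?s = "\<Sum>i\<in>S. x i"
  have x: "0 \<le> x y" "\<And>i. i \<in> S \<Longrightarrow> 0 \<le> x i" and s: "0 \<le> ?s"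
    using insert.prems by (auto intro: sum_nonneg)
  have c: "card S = Suc (card S - 1)"
    using insert.hyps by (metis Suc_pred' card_gt_0_iff)
  have "(\<Prod>j\<in>insert y S - {k}. x j) = x y * (\<Prod>j\<in>S - {k}. x j)" if "k \<in> S" for k
  proof -
    have "insert y S - {k} = insert y (S - {k})"
      using that insert.hyps by auto
    then show ?thesis using insert.hyps by simp
  qed
  then have "(\<Sum>k\<in>insert y S. \<Prod>j\<in>insert y S - {k}. x j)
      = (\<Prod>j\<in>S. x j) + x y * (\<Sum>k\<in>S. \<Prod>j\<in>S - {k}. x j)"
    using insert.hyps by (simp add: sum_distrib_left)
  also have "(\<Prod>j\<in>S. x j) \<le> (\<Prod>j\<in>S. ?s)"
    using x insert.hyps by (intro prod_mono) (auto intro: member_le_sum)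
  also have "(\<Prod>j\<in>S. ?s) = ?s * ?s ^ (card S - 1)"
    using c by (metis power_Suc prod_constant)
  also have "x y * (\<Sum>k\<in>S. \<Prod>j\<in>S - {k}. x j) \<le> x y * ?s ^ (card S - 1)"
    using insert.IH x by (intro mult_left_mono) auto
  also have "?s * ?s ^ (card S - 1) + x y * ?s ^ (card S - 1) = (x y + ?s) * ?s ^ (card S - 1)"
    by (simp add: algebra_simps)
  also have "\<dots> \<le> (x y + ?s) * (x y + ?s) ^ (card S - 1)"
    using x s by (intro mult_left_mono power_mono) auto
  also have "\<dots> = (\<Sum>i\<in>insert y S. x i) ^ (card (insert y S) - 1)"
    using insert.hyps c by (metis card_insert_disjoint diff_Suc_1 power_Suc sum.insert)
  finally show ?case by simp
qed

lemma frobenius_norm_power2_eq_sum_columns: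
  "(frobenius_norm A)\<^sup>2 = (\<Sum>j\<in>UNIV. (norm (transpose A $ j))\<^sup>2)"
  unfolding norm_power2_eq_sum
  by (subst sum.swap) (simp add: frobenius_norm_def sum_nonneg transpose_def)

text \<open>
  Since the Frobenius norm bounds every singular value of \<open>A\<close> and \<open>cmod (det A)\<close> is their product,
  the least one is at least \<open>cmod (det A) / frobenius_norm A ^ (n - 1)\<close>, where \<open>n = CARD('n)\<close>.
  The proof compares determinants instead of singular values: by Cramer's rule \<open>det A\<close> times the
  \<open>k\<close>-th coordinate of \<open>h\<close> is the determinant of \<open>A\<close> with its \<open>k\<close>-th column replaced by \<open>A *v h\<close>;
  Hadamard's inequality bounds it, and summing the squares over \<open>k\<close> produces the symmetric
  polynomial in the squared column norms that the preceding estimate controls.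
\<close>

lemma det_mult_norm_le:
  fixes A :: "complex ^ 'n ^ 'n"
  shows "cmod (det A) * norm h \<le> norm (A *v h) * frobenius_norm A ^ (CARD('n) - 1)"
proof (rule power2_le_imp_le)
  define c where "c j = norm (transpose A $ j)" for j
  have k: "cmod (det A) * cmod (h $ k) \<le> norm (A *v h) * (\<Prod>j\<in>UNIV - {k}. c j)" for k
  proof -
    let ?M = "(\<chi> i j. if j = k then (A *v h) $ i else A $ i $ j) :: complex ^ 'n ^ 'n"
    have "cmod (det A) * cmod (h $ k) = cmod (det (transpose ?M))"
      by (simp add: cramer_lemma norm_mult)
    also have "\<dots> \<le> (\<Prod>j\<in>UNIV. norm (transpose ?M $ j))"
      by (rule hadamard_rows)
    also have "\<dots> = norm (transpose ?M $ k) * (\<Prod>j\<in>UNIV - {k}. norm (transpose ?M $ j))"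
      by (rule prod.remove) auto
    also have "transpose ?M $ k = A *v h"
      by (simp add: transpose_def vec_eq_iff)
    also have "(\<Prod>j\<in>UNIV - {k}. norm (transpose ?M $ j)) = (\<Prod>j\<in>UNIV - {k}. c j)"
      by (rule prod.cong) (auto simp: transpose_def c_def)
    finally show ?thesis .
  qed
  have "(cmod (det A) * norm h)\<^sup>2 = (\<Sum>k\<in>UNIV. (cmod (det A) * cmod (h $ k))\<^sup>2)"
    by (simp add: power_mult_distrib norm_power2_eq_sum sum_distrib_left)
  also have "\<dots> \<le> (\<Sum>k\<in>UNIV. (norm (A *v h) * (\<Prod>j\<in>UNIV - {k}. c j))\<^sup>2)"
    by (intro sum_mono power_mono k) auto
  also have "\<dots> = (norm (A *v h))\<^sup>2 * (\<Sum>k\<in>UNIV. \<Prod>j\<in>UNIV - {k}. (c j)\<^sup>2)"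
    by (simp add: power_mult_distrib sum_distrib_left prod_power_distrib)
  also have "\<dots> \<le> (norm (A *v h))\<^sup>2 * (\<Sum>j\<in>UNIV. (c j)\<^sup>2) ^ (CARD('n) - 1)"
    by (intro mult_left_mono sum_prod_remove_le_power) auto
  also have "\<dots> = (norm (A *v h) * frobenius_norm A ^ (CARD('n) - 1))\<^sup>2"
    unfolding c_def frobenius_norm_power2_eq_sum_columns[symmetric] power_mult_distrib
    by (simp only: power_mult[symmetric] mult.commute)
  finally show "(cmod (det A) * norm h)\<^sup>2 \<le> (norm (A *v h) * frobenius_norm A ^ (CARD('n) - 1))\<^sup>2" .
qed (simp add: frobenius_norm_def sum_nonneg)

section \<open>Schwarz estimates for the derivative\<close>

lemma bounded_linear_vector_scalar_mult_left: "bounded_linear (\<lambda>c. c *s (e :: complex ^ 'n))"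
proof (rule bounded_linear_intro)
  show "norm (c *s e) \<le> norm c * norm e" for c
    by (simp add: norm_vector_scalar_mult)
  show "(r *\<^sub>R c) *s e = r *\<^sub>R (c *s e)" for r c
    by (simp add: vec_eq_iff)
qed (rule vector_sadd_rdistrib)

lemma has_field_derivative_along_line:
  fixes F :: "complex ^ 'n \<Rightarrow> complex"
  assumes "(F has_derivative F') (at (p + \<zeta> *s e))" and "\<And>c h. F' (c *s h) = c * F' h"
  shows "((\<lambda>\<zeta>. F (p + \<zeta> *s e)) has_field_derivative F' e) (at \<zeta>)"
proof -
  have "((\<lambda>\<zeta>. p + \<zeta> *s e) has_derivative (\<lambda>c. c *s e)) (at \<zeta>)"
    using has_derivative_add[OF has_derivative_const
        bounded_linear.has_derivative[OF bounded_linear_vector_scalar_mult_left has_derivative_ident]]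
    by simp
  from diff_chain_at[OF this assms(1)]
  show ?thesis
    by (simp add: has_field_derivative_def o_def assms(2) mult_commute_abs)
qed

lemma Schwarz_Lemma_scaled:
  assumes hol: "g holomorphic_on ball 0 r" and "g 0 = 0"
    and bound: "\<And>z. cmod z < r \<Longrightarrow> cmod (g z) < C" and \<zeta>: "cmod \<zeta> < r"
  shows "cmod (g \<zeta>) \<le> C * cmod \<zeta> / r"
proof -
  have r: "0 < r"
    using \<zeta> norm_ge_zero[of \<zeta>] by linarith
  have C: "0 < C"
    using bound[OF \<zeta>] norm_ge_zero[of "g \<zeta>"] by linarith
  define h where "h w = g (of_real r * w) / of_real C" for w
  have "(\<lambda>w. g (of_real r * w)) holomorphic_on ball 0 1"
    by (rule holomorphic_on_compose_gen[OF _ hol, unfolded o_def])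
       (use r in \<open>auto intro!: holomorphic_intros simp: norm_mult\<close>)
  then have "h holomorphic_on ball 0 1"
    unfolding h_def using C by (intro holomorphic_on_divide holomorphic_on_const) auto
  moreover have "cmod (h w) < 1" if "cmod w < 1" for w
    using bound[of "of_real r * w"] that r C by (simp add: h_def norm_mult norm_divide)
  ultimately have "cmod (h (\<zeta> / of_real r)) \<le> cmod (\<zeta> / of_real r)"
    using \<zeta> r by (intro Schwarz_Lemma) (auto simp: norm_divide, simp_all add: h_def \<open>g 0 = 0\<close>)
  then show ?thesis
    using r C by (simp add: h_def norm_divide field_simps)
qed

text \<open>
  Schwarz's lemma for the function \<open>F' z u - F' a u\<close> of \<open>z\<close> on the complex line through \<open>a\<close> and \<open>z\<close>. To
  apply it directly one would need to know that \<open>z \<mapsto> F' z u\<close> is holomorphic, whereas only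
  differentiability of \<open>F\<close> at each point is given. The difference quotients of \<open>F\<close> in the direction
  \<open>u\<close> are holomorphic on the line and inherit the bound \<open>M\<close> by the mean value inequality. So the
  lemma is applied to them, on a slightly smaller disc, and the resulting inequality is then
  passed to the limit.
\<close>

lemma Schwarz_directional_derivative:
  fixes F :: "complex ^ 'n \<Rightarrow> complex"
  assumes der: "\<And>z. z \<in> ball a r \<Longrightarrow> (F has_derivative F' z) (at z)"
    and hom: "\<And>z c h. F' z (c *s h) = c * F' z h"
    and bound: "\<And>z. z \<in> ball a r \<Longrightarrow> cmod (F' z u) \<le> M"
    and z: "z \<in> ball a r"
  shows "cmod (F' z u - F' a u) \<le> (M + cmod (F' a u)) * norm (z - a) / r"
proof (cases "z = a")
  case False
  define x where "x = norm (z - a)"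
  define e where "e = complex_of_real (1 / x) *s (z - a)"
  have x: "0 < x" "x < r"
    using False z by (auto simp: x_def dist_norm norm_minus_commute)
  have e: "norm e = 1"
    using x unfolding e_def norm_vector_scalar_mult by (simp add: norm_divide flip: x_def)
  have ze: "a + complex_of_real x *s e = z"
    using x by (simp add: e_def vector_smult_assoc)
  define q where "q s \<zeta> = (F ((a + \<zeta> *s e) + s *s u) - F (a + \<zeta> *s e)) / s" for s \<zeta>
  have in_ball: "a + \<zeta> *s e + s *s u \<in> ball a r" if "cmod \<zeta> + cmod s * norm u < r" for \<zeta> s
  proof -
    have "norm (\<zeta> *s e + s *s u) \<le> cmod \<zeta> + cmod s * norm u"
      by (rule order_trans[OF norm_triangle_ineq]) (simp add: norm_vector_scalar_mult e)
    then have "norm (\<zeta> *s e + s *s u) < r" using that by linarith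
    then show ?thesis
      by (simp add: dist_norm add.assoc flip: norm_minus_cancel[of "\<zeta> *s e + s *s u"])
  qed
  have ineq: "cmod (q s x - q s 0) \<le> (M + cmod (q s 0) + cmod s) * x / (r - cmod s * norm u)"
    if s: "s \<noteq> 0" "cmod s * norm u < r - x" for s
  proof -
    \<comment> \<open>The radius of the disc on which all points \<open>a + \<zeta> *s e + \<sigma> *s u\<close> with \<open>cmod \<sigma> \<le> cmod s\<close> stay in the ball.\<close>
    define r' where "r' = r - cmod s * norm u"
    have qM: "cmod (q s \<zeta>) \<le> M" if "cmod \<zeta> < r'" for \<zeta>
    proof -
      have *: "a + \<zeta> *s e + \<sigma> *s u \<in> ball a r" if "\<sigma> \<in> cball 0 (cmod s)" for \<sigma>
      proof (rule in_ball)
        have "cmod \<sigma> * norm u \<le> cmod s * norm u"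
          using that by (intro mult_right_mono) auto
        then show "cmod \<zeta> + cmod \<sigma> * norm u < r"
          using \<open>cmod \<zeta> < r'\<close> unfolding r'_def by linarith
      qed
      have "cmod (F (a + \<zeta> *s e + s *s u) - F (a + \<zeta> *s e + 0 *s u)) \<le> M * cmod (s - 0)"
      proof (rule field_differentiable_bound[where S = "cball 0 (cmod s)"
            and f = "\<lambda>\<sigma>. F (a + \<zeta> *s e + \<sigma> *s u)" and f' = "\<lambda>\<sigma>. F' (a + \<zeta> *s e + \<sigma> *s u) u"])
        show "((\<lambda>\<sigma>. F (a + \<zeta> *s e + \<sigma> *s u)) has_field_derivative F' (a + \<zeta> *s e + \<sigma> *s u) u)
            (at \<sigma> within cball 0 (cmod s))" if "\<sigma> \<in> cball 0 (cmod s)" for \<sigma>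
          by (rule has_field_derivative_at_within, rule has_field_derivative_along_line)
             (rule der[OF *[OF that]], rule hom)
        show "cmod (F' (a + \<zeta> *s e + \<sigma> *s u) u) \<le> M" if "\<sigma> \<in> cball 0 (cmod s)" for \<sigma>
          by (intro bound * that)
      qed auto
      then show ?thesis
        using s by (simp add: q_def norm_divide field_simps)
    qed
    have "(\<lambda>\<zeta>. F (a + \<zeta> *s e + s *s u)) holomorphic_on ball 0 r'"
         "(\<lambda>\<zeta>. F (a + \<zeta> *s e)) holomorphic_on ball 0 r'"
    proof -
      have "(\<lambda>\<zeta>. F (a + \<sigma> *s u + \<zeta> *s e)) holomorphic_on ball 0 r'" if "cmod \<sigma> \<le> cmod s" for \<sigma>
        unfolding holomorphic_on_def field_differentiable_def
      proof (intro ballI exI, rule has_field_derivative_at_within,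
             rule has_field_derivative_along_line[OF der hom])
        fix \<zeta> assume "\<zeta> \<in> ball (0::complex) r'"
        moreover have "cmod \<sigma> * norm u \<le> cmod s * norm u"
          using that by (intro mult_right_mono) auto
        ultimately show "a + \<sigma> *s u + \<zeta> *s e \<in> ball a r"
          using in_ball[of \<zeta> \<sigma>] by (simp add: r'_def add_ac)
      qed
      from this[of s] this[of 0] show
        "(\<lambda>\<zeta>. F (a + \<zeta> *s e + s *s u)) holomorphic_on ball 0 r'"
        "(\<lambda>\<zeta>. F (a + \<zeta> *s e)) holomorphic_on ball 0 r'"
        by (simp_all add: add_ac)
    qed
    then have "(\<lambda>\<zeta>. q s \<zeta> - q s 0) holomorphic_on ball 0 r'"
      unfolding q_def using s by (intro holomorphic_intros) auto
    \<comment> \<open>The summand \<open>cmod s\<close> makes the bound strict, as Schwarz's lemma asks; it vanishes in the limit.\<close>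
    moreover have "cmod (q s \<zeta> - q s 0) < M + cmod (q s 0) + cmod s" if "cmod \<zeta> < r'" for \<zeta>
    proof -
      have "cmod (q s \<zeta> - q s 0) \<le> M + cmod (q s 0)"
        by (rule order_trans[OF norm_triangle_ineq4]) (simp add: qM that)
      moreover have "0 < cmod s" using s by simp
      ultimately show ?thesis by linarith
    qed
    moreover have "cmod (complex_of_real x) < r'"
      using s x by (simp add: r'_def)
    ultimately have "cmod (q s x - q s 0) \<le> (M + cmod (q s 0) + cmod s) * cmod (complex_of_real x) / r'"
      by (intro Schwarz_Lemma_scaled[where g = "\<lambda>\<zeta>. q s \<zeta> - q s 0"]) auto
    then show ?thesis
      using x by (simp add: r'_def)
  qed
  have lim: "((\<lambda>s. q s \<zeta>) \<longlongrightarrow> F' (a + \<zeta> *s e) u) (at 0)" if "cmod \<zeta> < r" for \<zeta>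
  proof -
    have "((\<lambda>s. F (a + \<zeta> *s e + s *s u)) has_field_derivative F' (a + \<zeta> *s e) u) (at 0)"
      by (rule has_field_derivative_along_line[OF _ hom]) (use der in_ball[of \<zeta> 0] that in simp)
    then show ?thesis
      by (simp add: q_def has_field_derivative_iff)
  qed
  have small: "\<forall>\<^sub>F s in at 0. cmod s * norm u < r - x"
  proof -
    have "((\<lambda>s. cmod s * norm u) \<longlongrightarrow> cmod 0 * norm u) (at 0)"
      by (intro tendsto_intros)
    then show ?thesis
      using x by (intro order_tendstoD(2)) auto
  qed
  have "cmod (F' (a + complex_of_real x *s e) u - F' (a + 0 *s e) u)
      \<le> (M + cmod (F' (a + 0 *s e) u) + cmod 0) * x / (r - cmod 0 * norm u)"
  proof (rule tendsto_le)
    show "((\<lambda>s. cmod (q s x - q s 0)) \<longlongrightarrow>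
        cmod (F' (a + complex_of_real x *s e) u - F' (a + 0 *s e) u)) (at 0)"
      using x by (intro tendsto_intros lim) auto
    show "((\<lambda>s. (M + cmod (q s 0) + cmod s) * x / (r - cmod s * norm u)) \<longlongrightarrow>
        (M + cmod (F' (a + 0 *s e) u) + cmod 0) * x / (r - cmod 0 * norm u)) (at 0)"
      using x by (intro tendsto_intros lim) auto
    show "\<forall>\<^sub>F s in at 0. cmod (q s x - q s 0)
        \<le> (M + cmod (q s 0) + cmod s) * x / (r - cmod s * norm u)"
      using small eventually_neq_at_within[of 0]
      by eventually_elim (rule ineq)
  qed simp
  then show ?thesis
    using ze by (simp add: x_def)
qed simp

text \<open>
  Cauchy's inequality on discs in the direction \<open>u\<close> bounds the derivative near \<open>a\<close>, and the
  preceding lemma turns this bound into a Lipschitz estimate at \<open>a\<close>.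
\<close>

lemma continuous_on_directional_derivative:
  fixes F :: "complex ^ 'n \<Rightarrow> complex"
  assumes "open U"
    and der: "\<And>z. z \<in> U \<Longrightarrow> (F has_derivative F' z) (at z)"
    and hom: "\<And>z c h. F' z (c *s h) = c * F' z h"
  shows "continuous_on U (\<lambda>z. F' z u)"
  unfolding continuous_on_eq_continuous_at[OF \<open>open U\<close>]
proof
  fix a assume "a \<in> U"
  then obtain R where R: "0 < R" "cball a R \<subseteq> U"
    using \<open>open U\<close> open_contains_cball by metis
  have "continuous_on (cball a R) F"
    using der R by (intro continuous_at_imp_continuous_on ballI) (blast intro: has_derivative_continuous)
  then have "bounded (F ` cball a R)"
    by (intro compact_imp_bounded compact_continuous_image) auto
  then obtain C where C: "\<And>z. z \<in> cball a R \<Longrightarrow> cmod (F z) \<le> C"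
    unfolding bounded_iff by blast
  \<comment> \<open>Steps of length at most \<open>\<delta>\<close> in direction \<open>u\<close> lead from the half ball to points of \<open>cball a R\<close>.\<close>
  define \<delta> where "\<delta> = R / (2 * (norm u + 1))"
  have \<delta>: "0 < \<delta>" "\<delta> * norm u \<le> R / 2"
    using R by (auto simp: \<delta>_def field_simps add_pos_nonneg)
  have bound: "cmod (F' z u) \<le> C / \<delta>" if z: "z \<in> ball a (R / 2)" for z
  proof -
    have in_ball: "z + \<zeta> *s u \<in> cball a R" if "\<zeta> \<in> cball 0 \<delta>" for \<zeta>
    proof -
      have "norm (\<zeta> *s u) \<le> \<delta> * norm u"
        using that by (auto simp: norm_vector_scalar_mult intro: mult_right_mono)
      moreover have "dist a (z + \<zeta> *s u) \<le> dist a z + norm (\<zeta> *s u)"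
        using dist_triangle[of a "z + \<zeta> *s u" z] by (simp add: dist_norm)
      ultimately show ?thesis
        using z \<delta> by simp
    qed
    have fd: "((\<lambda>\<zeta>. F (z + \<zeta> *s u)) has_field_derivative F' (z + \<zeta> *s u) u) (at \<zeta>)"
      if "\<zeta> \<in> cball 0 \<delta>" for \<zeta>
      using in_ball[OF that] R by (intro has_field_derivative_along_line der hom) auto
    have "cmod ((deriv ^^ 1) (\<lambda>\<zeta>. F (z + \<zeta> *s u)) 0) \<le> fact 1 * C / \<delta> ^ 1"
    proof (rule Cauchy_inequality)
      show "(\<lambda>\<zeta>. F (z + \<zeta> *s u)) holomorphic_on ball 0 \<delta>"
        unfolding holomorphic_on_def field_differentiable_def
        using ball_subset_cball by (blast intro: has_field_derivative_at_within[OF fd])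
      show "continuous_on (cball 0 \<delta>) (\<lambda>\<zeta>. F (z + \<zeta> *s u))"
        by (intro continuous_at_imp_continuous_on ballI DERIV_isCont[OF fd])
      show "cmod (F (z + \<zeta> *s u)) \<le> C" if "cmod (0 - \<zeta>) = \<delta>" for \<zeta>
        using that by (intro C in_ball) simp
    qed (use \<delta> in simp)
    moreover have "deriv (\<lambda>\<zeta>. F (z + \<zeta> *s u)) 0 = F' z u"
      using fd[of 0] \<delta> by (intro DERIV_imp_deriv) simp
    ultimately show ?thesis by simp
  qed
  define K where "K = (C / \<delta> + cmod (F' a u)) / (R / 2)"
  have "\<forall>\<^sub>F z in at a. cmod (F' z u - F' a u) \<le> K * norm (z - a)"
  proof (rule eventually_at_in_open[THEN eventually_mono])
    show "open (ball a (R / 2))" "a \<in> ball a (R / 2)"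
      using R by auto
    fix z assume "z \<in> ball a (R / 2) - {a}"
    then have "cmod (F' z u - F' a u) \<le> (C / \<delta> + cmod (F' a u)) * norm (z - a) / (R / 2)"
      using R ball_subset_cball[of a "R / 2"]
      by (intro Schwarz_directional_derivative[of a "R / 2" F F'] der hom bound) auto
    then show "cmod (F' z u - F' a u) \<le> K * norm (z - a)"
      by (simp only: K_def times_divide_eq_left)
  qed
  moreover have "((\<lambda>z. K * norm (z - a)) \<longlongrightarrow> 0) (at a)"
    by (auto intro!: tendsto_eq_intros)
  ultimately have "((\<lambda>z. F' z u - F' a u) \<longlongrightarrow> 0) (at a)"
    by (rule Lim_null_comparison)
  then show "isCont (\<lambda>z. F' z u) a"
    unfolding isCont_def by (rule LIM_zero_cancel)
qed

lemma hermitian_inner_scalar_mult_left: "hermitian_inner (c *s x) y = c * hermitian_inner x y"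
  by (simp add: hermitian_inner_def sum_distrib_left mult.assoc)

lemma bounded_linear_hermitian_inner_left: "bounded_linear (\<lambda>x. hermitian_inner x v)"
proof (rule bounded_linear_intro)
  show "norm (hermitian_inner x v) \<le> norm x * norm v" for x
    by (rule norm_hermitian_inner_le)
qed (simp_all add: hermitian_inner_def distrib_right sum.distrib scaleR_sum_right)

text \<open>
  The vector-valued form follows by composing \<open>f\<close> with the complex linear functional that pairs
  with \<open>v = A z *v h - A a *v h\<close>, because on \<open>v\<close> this functional takes the value \<open>norm v\<close> squared.
\<close>

lemma norm_derivative_diff_le:
  fixes f :: "complex ^ 'n \<Rightarrow> complex ^ 'm" and A :: "complex ^ 'n \<Rightarrow> complex ^ 'n ^ 'm"
  assumes der: "\<And>z. z \<in> ball a r \<Longrightarrow> (f has_derivative (\<lambda>h. A z *v h)) (at z)"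
    and bound: "\<And>z h. z \<in> ball a r \<Longrightarrow> norm (A z *v h) \<le> M * norm h"
    and bound_a: "\<And>h. norm (A a *v h) \<le> m * norm h"
    and z: "z \<in> ball a r"
  shows "norm (A z *v h - A a *v h) \<le> (M + m) / r * norm (z - a) * norm h"
proof (cases "A z *v h - A a *v h = 0")
  case True
  have r: "0 < r" using z by (auto intro: le_less_trans[OF zero_le_dist])
  have "0 \<le> M * norm h + m * norm h"
    using bound[OF z, of h] bound_a[of h] norm_ge_zero[of "A z *v h"] norm_ge_zero[of "A a *v h"]
    by linarith
  then have "0 \<le> ((M + m) * norm h) * (norm (z - a) / r)"
    using r by (intro mult_nonneg_nonneg[of "(M + m) * norm h"]) (auto simp: distrib_right)
  then show ?thesis
    unfolding True by (simp add: mult_ac)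
next
  case False
  define v where "v = A z *v h - A a *v h"
  have v: "0 < norm v"
    using False by (simp add: v_def)
  have r: "0 < r" using z by (auto intro: le_less_trans[OF zero_le_dist])
  have "cmod (hermitian_inner (A z *v h) v - hermitian_inner (A a *v h) v)
      \<le> (M * norm h * norm v + cmod (hermitian_inner (A a *v h) v)) * norm (z - a) / r"
  proof (rule Schwarz_directional_derivative[where F = "\<lambda>w. hermitian_inner (f w) v" and F' = "\<lambda>w h. hermitian_inner (A w *v h) v"])
    show "((\<lambda>w. hermitian_inner (f w) v) has_derivative (\<lambda>h. hermitian_inner (A w *v h) v)) (at w)"
      if "w \<in> ball a r" for w
      by (rule bounded_linear.has_derivative[OF bounded_linear_hermitian_inner_left der[OF that]])
    show "hermitian_inner (A w *v (c *s h)) v = c * hermitian_inner (A w *v h) v" for w c h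
      by (simp add: vector_scalar_commute hermitian_inner_scalar_mult_left)
    show "cmod (hermitian_inner (A w *v h) v) \<le> M * norm h * norm v" if "w \<in> ball a r" for w
      by (rule order_trans[OF norm_hermitian_inner_le]) (intro mult_right_mono bound that norm_ge_zero)
  qed (rule z)
  also have "cmod (hermitian_inner (A a *v h) v) \<le> m * norm h * norm v"
    by (rule order_trans[OF norm_hermitian_inner_le]) (intro mult_right_mono bound_a norm_ge_zero)
  also have "hermitian_inner (A z *v h) v - hermitian_inner (A a *v h) v = hermitian_inner v v"
    unfolding v_def using linear_diff[OF bounded_linear.linear[OF bounded_linear_hermitian_inner_left]] by metis
  finally have "norm v * norm v \<le> ((M + m) / r * norm (z - a) * norm h) * norm v"
    using r by (simp add: hermitian_inner_self power2_eq_square norm_mult divide_right_mono mult_right_mono algebra_simps)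
  then show ?thesis
    using v by (simp only: mult_le_cancel_right_pos flip: v_def)
qed

lemma continuous_on_jacobian_entry:
  fixes f :: "complex ^ 'n \<Rightarrow> complex ^ 'm" and A :: "complex ^ 'n \<Rightarrow> complex ^ 'n ^ 'm"
  assumes "open U" and der: "\<And>z. z \<in> U \<Longrightarrow> (f has_derivative (\<lambda>h. A z *v h)) (at z)"
  shows "continuous_on U (\<lambda>z. A z $ i $ k)"
proof -
  have "continuous_on U (\<lambda>z. (A z *v axis k 1) $ i)"
  proof (rule continuous_on_directional_derivative[where F = "\<lambda>z. f z $ i" and F' = "\<lambda>z h. (A z *v h) $ i"])
    show "((\<lambda>z. f z $ i) has_derivative (\<lambda>h. (A z *v h) $ i)) (at z)" if "z \<in> U" for z
      by (rule bounded_linear.has_derivative[OF bounded_linear_vec_nth der[OF that]])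
  qed (simp_all add: \<open>open U\<close> vector_scalar_commute)
  then show ?thesis
    by (simp add: matrix_vector_mult_def axis_def if_distrib cong: if_cong)
qed

section \<open>Covering by maps with Lipschitz derivative\<close>

text \<open>
  On a compact smaller ball \<open>f\<close> differs from the linear map \<open>f' a\<close> by a map whose Lipschitz
  constant is below the expansion constant \<open>lam\<close> of \<open>f' a\<close>.
\<close>

lemma inj_on_ball_if_derivative_Lipschitz:
  fixes f :: "'a :: euclidean_space \<Rightarrow> 'b :: euclidean_space"
  assumes der: "\<And>z. z \<in> ball a \<rho> \<Longrightarrow> (f has_derivative f' z) (at z)"
    and lip: "\<And>z h. z \<in> ball a \<rho> \<Longrightarrow> norm (f' z h - f' a h) \<le> L * norm (z - a) * norm h"
    and low: "\<And>h. lam * norm h \<le> norm (f' a h)"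
    and "0 < L" "L * \<rho> \<le> lam"
  shows "inj_on f (ball a \<rho>)"
proof (rule inj_onI, rule ccontr)
  fix x y assume x: "x \<in> ball a \<rho>" and y: "y \<in> ball a \<rho>" and eq: "f x = f y" and ne: "x \<noteq> y"
  \<comment> \<open>Both points lie in a ball of radius \<open>s\<close> strictly below \<open>\<rho>\<close>, which makes the Lipschitz constant
    \<open>L * s\<close> strictly smaller than \<open>lam\<close>.\<close>
  define s where "s = max (dist a x) (dist a y)"
  have s: "s < \<rho>" "0 \<le> s" "x \<in> cball a s" "y \<in> cball a s"
    using x y by (auto simp: s_def max_def)
  have sub: "z \<in> ball a \<rho>" if "z \<in> cball a s" for z
    using that s by auto
  have lin: "bounded_linear (f' a)"
    using der[of a] s by (auto intro: has_derivative_bounded_linear)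
  have "norm ((f x - f' a x) - (f y - f' a y)) \<le> (L * s) * norm (x - y)"
  proof (rule differentiable_bound[where S = "cball a s"])
    fix z assume z: "z \<in> cball a s"
    show "((\<lambda>z. f z - f' a z) has_derivative (\<lambda>h. f' z h - f' a h)) (at z within cball a s)"
      by (intro has_derivative_diff has_derivative_at_withinI[OF der]
          bounded_linear_imp_has_derivative lin sub z)
    show "onorm (\<lambda>h. f' z h - f' a h) \<le> L * s"
    proof (rule onorm_bound)
      show "0 \<le> L * s" using \<open>0 < L\<close> s by simp
      have "norm (z - a) \<le> s"
        using z by (simp add: dist_norm norm_minus_commute)
      then have "L * norm (z - a) * norm h \<le> L * s * norm h" for h
        using \<open>0 < L\<close> by (intro mult_right_mono mult_left_mono) auto
      then show "norm (f' z h - f' a h) \<le> L * s * norm h" for h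
        using lip[OF sub[OF z], of h] by (rule order_trans[rotated])
    qed
  qed (use s in auto)
  then have "norm (f' a (y - x)) \<le> (L * s) * norm (y - x)"
    using eq linear_diff[OF bounded_linear.linear[OF lin]] by (simp add: norm_minus_commute)
  moreover have "(L * s) * norm (y - x) < lam * norm (y - x)"
  proof (rule mult_strict_right_mono)
    have "L * s < L * \<rho>" using s \<open>0 < L\<close> by simp
    then show "L * s < lam" using \<open>L * \<rho> \<le> lam\<close> by linarith
  qed (use ne in simp)
  ultimately show False
    using low[of "y - x"] by linarith
qed

text \<open>
  Integrating the growth of the derivative along the segment gives the factor 1/2; a supremum bound
  would lose it, and with it the radius \<open>lam\<^sup>2 / (2 * L)\<close> below. The integration is carried out
  by comparing derivatives with those of \<open>L * (norm (z - a))\<^sup>2 * t\<^sup>2 / 2\<close>.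
\<close>

lemma norm_remainder_le_if_derivative_Lipschitz:
  fixes f :: "'a :: euclidean_space \<Rightarrow> 'b :: euclidean_space"
  assumes der: "\<And>z. z \<in> ball a r \<Longrightarrow> (f has_derivative f' z) (at z)"
    and lip: "\<And>z h. z \<in> ball a r \<Longrightarrow> norm (f' z h - f' a h) \<le> L * norm (z - a) * norm h"
    and z: "z \<in> ball a r"
  shows "norm (f z - f a - f' a (z - a)) \<le> L * (norm (z - a))\<^sup>2 / 2"
proof -
  let ?v = "z - a"
  have in_ball: "a + t *\<^sub>R ?v \<in> ball a r" if "0 \<le> t" "t \<le> 1" for t
  proof -
    have "norm (t *\<^sub>R ?v) \<le> norm ?v"
      using that by (simp add: mult_left_le_one_le)
    moreover have "norm ?v < r"
      using z by (simp add: dist_norm norm_minus_commute)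
    ultimately show ?thesis
      by (simp add: dist_norm)
  qed
  define g where "g t = f (a + t *\<^sub>R ?v) - t *\<^sub>R f' a ?v" for t
  have vd: "(g has_vector_derivative (f' (a + t *\<^sub>R ?v) ?v - f' a ?v)) (at t)"
    if "0 \<le> t" "t \<le> 1" for t
  proof -
    have "((\<lambda>t. a + t *\<^sub>R ?v) has_derivative (\<lambda>t. t *\<^sub>R ?v)) (at t)"
      by (auto intro!: derivative_eq_intros)
    from diff_chain_at[OF this der[OF in_ball[OF that]]]
    have "((\<lambda>t. f (a + t *\<^sub>R ?v)) has_derivative (\<lambda>s. f' (a + t *\<^sub>R ?v) (s *\<^sub>R ?v))) (at t)"
      by (simp add: o_def)
    moreover have "f' (a + t *\<^sub>R ?v) (s *\<^sub>R ?v) = s *\<^sub>R f' (a + t *\<^sub>R ?v) ?v" for s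
      using has_derivative_linear[OF der[OF in_ball[OF that]]] by (rule linear_cmul)
    ultimately have "((\<lambda>t. f (a + t *\<^sub>R ?v)) has_vector_derivative f' (a + t *\<^sub>R ?v) ?v) (at t)"
      by (simp add: has_vector_derivative_def)
    then show ?thesis
      unfolding g_def by (auto intro!: derivative_eq_intros)
  qed
  have "norm (g 1 - g 0) \<le> L * (norm ?v)\<^sup>2 * 1\<^sup>2 / 2 - L * (norm ?v)\<^sup>2 * 0\<^sup>2 / 2"
  proof (rule differentiable_bound_general)
    show "continuous_on {0..1} g"
      by (intro continuous_at_imp_continuous_on ballI has_vector_derivative_continuous[OF vd]) auto
    show "((\<lambda>t. L * (norm ?v)\<^sup>2 * t\<^sup>2 / 2) has_vector_derivative L * (norm ?v)\<^sup>2 * t) (at t)" for t :: real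
      unfolding has_real_derivative_iff_has_vector_derivative[symmetric]
      by (auto intro!: derivative_eq_intros)
    show "norm (f' (a + t *\<^sub>R ?v) ?v - f' a ?v) \<le> L * (norm ?v)\<^sup>2 * t" if "0 < t" "t < 1" for t
      using lip[OF in_ball, of t ?v] that by (simp add: power2_eq_square mult_ac)
  qed (auto intro!: continuous_intros vd)
  then show ?thesis
    by (simp add: g_def algebra_simps)
qed

text \<open>
  Landau's covering argument. On \<open>ball a \<rho>\<close> with \<open>\<rho> = lam / L\<close> the map is injective, and on the bounding
  sphere it stays at least \<open>lam * \<rho> - L * \<rho>\<^sup>2 / 2 = lam\<^sup>2 / (2 * L)\<close> away from \<open>f a\<close>; this \<open>\<rho>\<close> maximizes
  the difference. The image meets the ball around \<open>f a\<close> in a relatively open set, by invariance of domain,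
  and in a relatively closed set, as the sphere contributes nothing and the closed ball is compact.
  So it covers the ball, and the part of \<open>ball a \<rho>\<close> above it is connected, being homeomorphic to it.
\<close>

lemma covers_ball_if_derivative_Lipschitz:
  fixes f :: "'a :: euclidean_space \<Rightarrow> 'a"
  assumes der: "\<And>z. z \<in> ball a r \<Longrightarrow> (f has_derivative f' z) (at z)"
    and lip: "\<And>z h. z \<in> ball a r \<Longrightarrow> norm (f' z h - f' a h) \<le> L * norm (z - a) * norm h"
    and low: "\<And>h. lam * norm h \<le> norm (f' a h)"
    and "0 < L" "0 < lam" "lam < L * r"
    and R: "0 < R" "R \<le> lam\<^sup>2 / (2 * L)"
  shows "\<exists>D. D \<subseteq> ball a r \<and> open D \<and> connected D \<and> D \<noteq> {} \<and> inj_on f D \<and> f ` D = ball (f a) R"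
proof -
  define \<rho> where "\<rho> = lam / L"
  have \<rho>: "0 < \<rho>" "\<rho> < r" "L * \<rho> = lam"
    using \<open>0 < L\<close> \<open>0 < lam\<close> \<open>lam < L * r\<close> by (auto simp: \<rho>_def field_simps)
  have sub: "cball a \<rho> \<subseteq> ball a r" and sub': "ball a \<rho> \<subseteq> ball a r"
    using \<rho> by auto
  let ?B = "ball (f a) R"
  have inj: "inj_on f (ball a \<rho>)"
    by (rule inj_on_ball_if_derivative_Lipschitz[where f' = f' and L = L and lam = lam])
       (use der lip low \<open>0 < L\<close> \<rho> sub' in auto)
  have cont: "continuous_on (cball a \<rho>) f"
    using der sub by (intro continuous_at_imp_continuous_on ballI) (blast intro: has_derivative_continuous)
  then have cont': "continuous_on (ball a \<rho>) f"
    by (rule continuous_on_subset) auto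
  have sphere: "f z \<notin> ?B" if "dist a z = \<rho>" for z
  proof -
    have z: "z \<in> ball a r" "norm (z - a) = \<rho>"
      using that \<rho> by (auto simp: dist_norm norm_minus_commute)
    have "norm (f z - f a - f' a (z - a)) \<le> L * \<rho>\<^sup>2 / 2"
      using norm_remainder_le_if_derivative_Lipschitz[of a r f f' L z] der lip z by auto
    moreover have "lam * \<rho> \<le> norm (f' a (z - a))"
      using low[of "z - a"] z by simp
    moreover have "norm (f' a (z - a)) - norm (f z - f a) \<le> norm (f z - f a - f' a (z - a))"
      by (metis norm_minus_commute norm_triangle_ineq2)
    moreover have "lam * \<rho> - L * \<rho>\<^sup>2 / 2 = lam\<^sup>2 / (2 * L)"
      using \<open>0 < L\<close> by (simp add: \<rho>_def field_simps power2_eq_square)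
    ultimately have "R \<le> norm (f z - f a)"
      using R by linarith
    then show ?thesis
      by (simp add: dist_norm norm_minus_commute)
  qed
  have eq: "f ` ball a \<rho> \<inter> ?B = f ` cball a \<rho> \<inter> ?B"
    using sphere by (fastforce simp: less_le)
  have "open (f ` ball a \<rho>)"
    by (rule invariance_of_domain[OF cont' open_ball inj])
  then have "openin (top_of_set ?B) (f ` ball a \<rho> \<inter> ?B)"
    by (simp add: openin_open_Int inf_commute)
  moreover have "closed (f ` cball a \<rho>)"
    by (intro compact_imp_closed compact_continuous_image cont compact_cball)
  then have "closedin (top_of_set ?B) (f ` ball a \<rho> \<inter> ?B)"
    unfolding eq by (simp add: closedin_closed_Int inf_commute)
  moreover have "f a \<in> f ` ball a \<rho> \<inter> ?B"
    using \<rho> R by auto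
  ultimately have "f ` ball a \<rho> \<inter> ?B = ?B"
    using connected_clopen[THEN iffD1, OF connected_ball] by blast
  then have covers: "?B \<subseteq> f ` ball a \<rho>"
    by blast
  obtain g where g: "homeomorphism (ball a \<rho>) (f ` ball a \<rho>) f g"
    using invariance_of_domain_homeomorphism[OF open_ball cont' order_refl inj] by blast
  let ?D = "ball a \<rho> \<inter> f -` ?B"
  have "?D = g ` ?B"
    using g covers by (force simp: homeomorphism_def)
  moreover have "continuous_on ?B g"
    using g covers by (auto simp: homeomorphism_def intro: continuous_on_subset)
  ultimately have "connected ?D"
    by (simp add: connected_continuous_image)
  moreover have "open ?D"
    by (rule continuous_open_preimage[OF cont' open_ball open_ball])
  moreover have "f ` ?D = ?B"
    using covers by auto
  moreover have "a \<in> ?D"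
    using \<rho> R by simp
  moreover have "inj_on f ?D"
    using inj by (rule inj_on_subset) auto
  ultimately show ?thesis
    using sub' by (intro exI[of _ ?D]) blast
qed

section \<open>Bloch radius of Bochner mappings\<close>

text \<open>
  Choose \<open>a\<close> as a maximum point of \<open>(1 - norm z) ^ n * cmod (det (A z))\<close>. Moving from \<open>a\<close> by at most
  half its distance \<open>t\<close> to the sphere halves \<open>1 - norm z\<close> at worst, so the \<open>n\<close>-th root of the modulus
  of the determinant, whose value at \<open>a\<close> is \<open>d\<close>, at most doubles. Comparison with the origin gives \<open>1 \<le> t * d\<close>.
\<close>

lemma exists_dominating_point:
  fixes f :: "complex ^ 'n \<Rightarrow> complex ^ 'n" and A :: "complex ^ 'n \<Rightarrow> complex ^ 'n ^ 'n"
  assumes "open U" "cball 0 1 \<subseteq> U"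
    and der: "\<And>z. z \<in> U \<Longrightarrow> (f has_derivative (\<lambda>h. A z *v h)) (at z)"
    and det0: "cmod (det (A 0)) = 1"
  obtains a t d where "0 < t" "t = 1 - norm a" "1 \<le> t * d" "cmod (det (A a)) = d ^ CARD('n)"
    "\<And>z. z \<in> ball a (t / 2) \<Longrightarrow> z \<in> ball 0 1 \<and> cmod (det (A z)) \<le> (2 * d) ^ CARD('n)"
proof -
  let ?n = "CARD('n)"
  define \<psi> where "\<psi> z = (1 - norm z) ^ ?n * cmod (det (A z))" for z
  have "continuous_on U \<psi>"
    unfolding \<psi>_def det_def
    by (intro continuous_intros continuous_on_jacobian_entry[OF \<open>open U\<close> der])
  then have "continuous_on (cball 0 1) \<psi>"
    using assms(2) by (rule continuous_on_subset)
  then obtain a where a: "a \<in> cball 0 1" and max: "\<And>z. z \<in> cball 0 1 \<Longrightarrow> \<psi> z \<le> \<psi> a"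
    using continuous_attains_sup[of "cball 0 1" \<psi>] by auto
  have "1 \<le> \<psi> a"
    using max[of 0] det0 by (simp add: \<psi>_def)
  define t where "t = 1 - norm a"
  define d where "d = root ?n (cmod (det (A a)))"
  have d: "0 \<le> d" "d ^ ?n = cmod (det (A a))"
    by (simp_all add: d_def)
  have "t \<noteq> 0"
    using \<open>1 \<le> \<psi> a\<close> by (auto simp: \<psi>_def t_def power_0_left)
  then have t: "0 < t"
    using a by (simp add: t_def)
  have \<psi>a: "\<psi> a = (t * d) ^ ?n"
    by (simp add: \<psi>_def power_mult_distrib d t_def)
  have td: "1 \<le> t * d"
  proof (rule ccontr)
    assume "\<not> 1 \<le> t * d"
    then have "(t * d) ^ ?n < 1 ^ ?n"
      using t d by (intro power_strict_mono) auto
    then show False using \<open>1 \<le> \<psi> a\<close> \<psi>a by simp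
  qed
  have "z \<in> ball 0 1 \<and> cmod (det (A z)) \<le> (2 * d) ^ ?n" if z: "z \<in> ball a (t / 2)" for z
  proof -
    have "norm z \<le> norm a + dist a z"
      by (metis dist_norm norm_minus_commute norm_triangle_sub)
    then have z': "t / 2 \<le> 1 - norm z"
      using z unfolding t_def mem_ball by argo
    then have "(t / 2) ^ ?n * cmod (det (A z)) \<le> \<psi> z"
      unfolding \<psi>_def using t by (intro mult_right_mono power_mono) auto
    also have "\<dots> \<le> (t * d) ^ ?n"
      unfolding \<psi>a[symmetric] using z' t by (intro max) simp
    also have "\<dots> = (t / 2) ^ ?n * (2 * d) ^ ?n"
      unfolding power_mult_distrib[symmetric] by simp
    finally show ?thesis
      using t z' by (simp add: mult_le_cancel_left_pos)
  qed
  then show thesis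
    using that[OF t t_def td] d by simp
qed

theorem theorem1:
  fixes f :: "complex ^ 'n \<Rightarrow> complex ^ 'n" and K K' :: real
  assumes "CARD('n) \<ge> 2" and "K \<ge> 1" and "K' \<ge> 0"
    and "bochner_map_on K K' f (cball 0 1)"
    and "cmod (det (cjacobian f 0)) = 1"
  shows "bloch_radius CARD('n) K K' > 0 \<and>
    (\<exists>D w. D \<subseteq> ball 0 1 \<and> open D \<and> connected D \<and> D \<noteq> {} \<and>
       inj_on f D \<and> f ` D = ball w (bloch_radius CARD('n) K K'))"
proof -
  let ?n = "CARD('n)" and ?J = "cjacobian f" and ?R = "bloch_radius CARD('n) K K'"
  \<comment> \<open>Up to the factor \<open>d\<close> below, \<open>M\<close> and \<open>m\<close> bound the Frobenius norm of the Jacobian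
    near the dominating point and at it, respectively.\<close>
  define M where "M = sqrt (4 * K\<^sup>2 + K')"
  define m where "m = sqrt (K\<^sup>2 + K')"
  have K2: "1 \<le> K\<^sup>2"
    using \<open>K \<ge> 1\<close> by simp
  have M: "0 < M" "M\<^sup>2 = 4 * K\<^sup>2 + K'"
    unfolding M_def using K2 \<open>K' \<ge> 0\<close> by auto
  have m: "1 \<le> m" "m\<^sup>2 = K\<^sup>2 + K'"
    unfolding m_def using K2 \<open>K' \<ge> 0\<close> by auto
  have "(m ^ (?n - 1))\<^sup>2 = (K\<^sup>2 + K') ^ (?n - 1)"
    unfolding m(2)[symmetric] by (simp only: power_mult[symmetric] mult.commute)
  then have R_eq: "?R = 1 / (4 * (m ^ (?n - 1))\<^sup>2 * (M + m))"
    unfolding bloch_radius_def M_def[symmetric] m_def[symmetric]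
    by (simp only: divide_inverse inverse_mult_distrib mult.assoc)
  have R_pos: "0 < ?R"
    unfolding R_eq using M m by simp
  obtain U where U: "open U" "cball 0 1 \<subseteq> U" "f holomorphic_map_on U"
    and bochner: "\<And>z. z \<in> cball 0 1 \<Longrightarrow>
      (frobenius_norm (?J z))\<^sup>2 \<le> K\<^sup>2 * cmod (det (?J z)) powr (2 / real ?n) + K'"
    using assms(4) unfolding bochner_map_on_def by blast
  have der: "(f has_derivative (\<lambda>h. ?J z *v h)) (at z)" if "z \<in> U" for z
    using U(3) that cjacobian_eq_derivative unfolding holomorphic_map_on_def by blast
  obtain a t d where t: "0 < t" "t = 1 - norm a" and td: "1 \<le> t * d"
    and det_a: "cmod (det (?J a)) = d ^ ?n"
    and near: "\<And>z. z \<in> ball a (t / 2) \<Longrightarrow> z \<in> ball 0 1 \<and> cmod (det (?J z)) \<le> (2 * d) ^ ?n"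
    by (rule exists_dominating_point[OF U(1,2) der assms(5)], assumption) (rule that; blast)
  have "0 < t * d"
    using td by linarith
  then have "0 < d"
    using t by (simp add: zero_less_mult_iff)
  have "t * d \<le> 1 * d"
    using t \<open>0 < d\<close> by (intro mult_right_mono) auto
  then have d: "1 \<le> d"
    using td by simp
  have frobenius_le: "frobenius_norm (?J z) \<le> d * sqrt (c\<^sup>2 * K\<^sup>2 + K')"
    if z: "z \<in> cball 0 1" "cmod (det (?J z)) \<le> (c * d) ^ ?n" and "0 < c" for z c
  proof (rule power2_le_imp_le)
    have "cmod (det (?J z)) powr (2 / real ?n) \<le> ((c * d) ^ ?n) powr (2 / real ?n)"
      using z by (intro powr_mono2) auto
    also have "\<dots> = ((c * d) powr real ?n) powr (2 / real ?n)"
      using \<open>0 < c\<close> d by (subst powr_realpow) auto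
    also have "\<dots> = (c * d) powr 2"
      by (simp add: powr_powr)
    also have "\<dots> = (c * d)\<^sup>2"
      using \<open>0 < c\<close> d by simp
    finally have "K\<^sup>2 * cmod (det (?J z)) powr (2 / real ?n) \<le> K\<^sup>2 * (c * d)\<^sup>2"
      by (intro mult_left_mono) auto
    \<comment> \<open>Here \<open>d \<ge> 1\<close> makes the inequality homogeneous in \<open>d\<close>, absorbing the additive constant.\<close>
    moreover have "1 * K' \<le> d\<^sup>2 * K'"
      using d \<open>K' \<ge> 0\<close> by (intro mult_right_mono) auto
    ultimately have "(frobenius_norm (?J z))\<^sup>2 \<le> K\<^sup>2 * (c * d)\<^sup>2 + d\<^sup>2 * K'"
      using bochner[OF z(1)] by linarith
    also have "\<dots> = (d * sqrt (c\<^sup>2 * K\<^sup>2 + K'))\<^sup>2"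
      using \<open>K' \<ge> 0\<close> by (simp add: power_mult_distrib algebra_simps)
    finally show "(frobenius_norm (?J z))\<^sup>2 \<le> (d * sqrt (c\<^sup>2 * K\<^sup>2 + K'))\<^sup>2" .
  qed (use d \<open>K' \<ge> 0\<close> in simp)
  have a: "a \<in> ball a (t / 2)"
    using t by simp
  have frobenius_near: "frobenius_norm (?J z) \<le> d * M" if "z \<in> ball a (t / 2)" for z
    using frobenius_le[of z 2] near[OF that] by (simp add: M_def)
  have frobenius_a: "frobenius_norm (?J a) \<le> d * m"
    using frobenius_le[of a 1] near[OF a] det_a by (simp add: m_def)
  \<comment> \<open>The expansion constant of the Jacobian at \<open>a\<close>: the modulus \<open>d ^ n\<close> of the
    determinant over \<open>(d * m) ^ (n - 1)\<close>.\<close>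
  define lam where "lam = d / m ^ (?n - 1)"
  define L where "L = (d * M + d * m) / (t / 2)"
  have low: "lam * norm h \<le> norm (?J a *v h)" for h
  proof -
    have "d ^ ?n = d * d ^ (?n - 1)"
      using assms(1) by (cases ?n) auto
    then have "lam * norm h * (d * m) ^ (?n - 1) = d ^ ?n * norm h"
      using m by (simp add: lam_def power_mult_distrib)
    also have "\<dots> \<le> norm (?J a *v h) * frobenius_norm (?J a) ^ (?n - 1)"
      using det_mult_norm_le[of "?J a" h] det_a by simp
    also have "\<dots> \<le> norm (?J a *v h) * (d * m) ^ (?n - 1)"
      by (intro mult_left_mono power_mono frobenius_a) (auto simp: frobenius_norm_def sum_nonneg)
    finally show ?thesis
      using d m by (simp add: mult_le_cancel_right_pos)
  qed
  have lip: "norm (?J z *v h - ?J a *v h) \<le> L * norm (z - a) * norm h"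
    if "z \<in> ball a (t / 2)" for z h
    unfolding L_def
  proof (rule norm_derivative_diff_le[OF _ _ _ that])
    show "(f has_derivative (\<lambda>h. ?J w *v h)) (at w)" if "w \<in> ball a (t / 2)" for w
      using near[OF that] U(2) by (intro der) auto
    show "norm (?J w *v h) \<le> d * M * norm h" if "w \<in> ball a (t / 2)" for w h
      by (rule order_trans[OF norm_matrix_vector_mult_le])
         (intro mult_right_mono frobenius_near that norm_ge_zero)
    show "norm (?J a *v h) \<le> d * m * norm h" for h
      by (rule order_trans[OF norm_matrix_vector_mult_le])
         (intro mult_right_mono frobenius_a norm_ge_zero)
  qed
  have "\<exists>D. D \<subseteq> ball a (t / 2) \<and> open D \<and> connected D \<and> D \<noteq> {} \<and> inj_on f D \<and> f ` D = ball (f a) ?R"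
  proof (rule covers_ball_if_derivative_Lipschitz[OF _ lip low])
    show "(f has_derivative (\<lambda>h. ?J w *v h)) (at w)" if "w \<in> ball a (t / 2)" for w
      using near[OF that] U(2) by (intro der) auto
    show "0 < L" "0 < lam"
      using d m M t by (simp_all add: L_def lam_def add_pos_pos)
    have "lam \<le> d * 1"
      unfolding lam_def using d m by (simp add: divide_le_eq_1 field_simps)
    also have "d * 1 < d * (M + m)"
      using d m M by (intro mult_strict_left_mono) auto
    also have "\<dots> = L * (t / 2)"
      using t by (simp add: L_def distrib_left)
    finally show "lam < L * (t / 2)" .
    \<comment> \<open>The covered radius scales like \<open>t * d\<close>, which the choice of \<open>a\<close> made at least 1.\<close>
    have "lam\<^sup>2 / (2 * L) = (t * d) * ?R"
    proof -
      have "L = 2 * d * (M + m) / t"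
        by (simp add: L_def distrib_left)
      moreover have "0 < M + m" "0 < m ^ (?n - 1)"
        using M m by simp_all
      moreover have "(d / q)\<^sup>2 / (2 * (2 * d * s / t)) = (t * d) * (1 / (4 * q\<^sup>2 * s))"
        if "0 < s" "0 < q" for s q :: real
        using t(1) \<open>0 < d\<close> that by (simp add: power2_eq_square field_simps)
      ultimately show ?thesis
        unfolding lam_def R_eq by blast
    qed
    moreover have "1 * ?R \<le> (t * d) * ?R"
      using td R_pos by (intro mult_right_mono) auto
    ultimately show "?R \<le> lam\<^sup>2 / (2 * L)"
      by simp
  qed (assumption | rule R_pos)+
  moreover have "ball a (t / 2) \<subseteq> ball 0 1"
    using near by blast
  ultimately show ?thesis
    using R_pos by (meson subset_trans)
qed

end
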